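(* Let $\mathscr{H}_2$ be a separable real Hilbert space and let $K:\ell^2\to\mathscr{H}_2$ be a bounded linear operator that possesses the FBI property. Let $u^{\diamond}\in\ell^0$, $u^{\diamond}\neq0$, with $\operatorname{supp}(u^{\diamond})=I$, let $\eta\in\mathscr{H}_2$, and let $g^{\varepsilon}=Ku^{\diamond}+\eta$ be the noisy data with noise-to-signal ratio $$r_{\eta/u}:=\frac{\sup_{i\in\mathbb{Z}}|\langle\eta,Ke_i\rangle|}{\min_{i\in I}|u^{\diamond}_i|}.$$ Assume that $$\sup_{i\in I^{\complement}}\|(KP_I)^{\dagger}Ke_i\|_{\ell^1}<1-2\,r_{\eta/u}\,\|(P_IK^*KP_I)^{-1}\|_{\ell^1,\ell^1}.$$ Then there exists a regularization parameter $\alpha$ with $$\frac{1+\sup_{i\in I^{\complement}}\|(KP_I)^{\dagger}Ke_i\|_{\ell^1}}{1-\sup_{i\in I^{\complement}}\|(KP_I)^{\dagger}Ke_i\|_{\ell^1}}\;\sup_{i\in\mathbb{Z}}|\langle\eta,Ke_i\rangle|<\alpha<\frac{\min_{i\in I}|u^{\diamond}_i|}{\|(P_IK^*KP_I)^{-1}\|_{\ell^1,\ell^1}}-\sup_{i\in\mathbb{Z}}|\langle\eta,Ke_i\rangle| ,$$ and for every such $\alpha$, every minimizer $u^{\alpha,\varepsilon}\in\operatorname{arg\,min}_{u\in\ell^2}T_\alpha(u)$ satisfies $\operatorname{supp}(u^{\alpha,\varepsilon})=\operatorname{supp}(u^{\diamond})=I$.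
   Context: $\ell^2=\ell^2(\mathbb{Z},\mathbb{R})$ with standard basis $\{e_j\}_{j\in\mathbb{Z}}$; $\ell^0$ is the vector space of real sequences indexed by $\mathbb{Z}$ with only finitely many nonzero entries; $\operatorname{supp}(u)=\{i\in\mathbb{Z}: u_i\neq 0\}$; $I^{\complement}=\mathbb{Z}\setminus I$. FBI (finite basis injectivity) property of $K$: for every finite $J\subset\mathbb{Z}$, the restriction of $K$ to $\operatorname{span}\{e_i: i\in J\}$ is injective. For $J\subset\mathbb{Z}$, $P_J:\ell^2\to\ell^2$ is the projection $P_Ju=\sum_{j\in J}u_je_j$. $B^{\dagger}$ denotes the Moore–Penrose pseudoinverse of a linear operator $B$. $(P_IK^*KP_I)^{-1}$ is the inverse of $P_IK^*KP_I$ regarded as an operator on the finite-dimensional space $\operatorname{span}\{e_i: i\in I\}$ (invertible by the FBI property), and $\|\cdot\|_{\ell^1,\ell^1}$ is its operator norm with respect to the $\ell^1$-norm on domain and target. The $\ell^1$-penalized Tikhonov functional with $\alpha>0$ is $T_\alpha(u)=\tfrac12\|Ku-g^{\varepsilon}\|_{\mathscr{H}_2}^2+\alpha\|u\|_{\ell^1}$ for $u\in\ell^2$, where $\|u\|_{\ell^1}=\infty$ if $u\in\ell^2\setminus\ell^1$. *)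

theory Defs
  imports "HOL-Analysis.Analysis"
begin

section \<open>The real sequence space $\ell^2(\mathbb{Z})$\<close>

typedef ell2 = "{u :: int \<Rightarrow> real. (\<lambda>i. (u i)\<^sup>2) summable_on UNIV}"
  morphisms coord Abs_ell2
  by (rule exI[of _ "\<lambda>_. 0"]) simp

setup_lifting type_definition_ell2

lemma ell2_eqI: "(\<And>i. coord u i = coord v i) \<Longrightarrow> u = v"
  by (metis coord_inject ext)

lemma coord_square_summable: "(\<lambda>i. (coord u i)\<^sup>2) summable_on UNIV"
  using coord by blast

lemma square_summable_prod:
  fixes u v :: "int \<Rightarrow> real"
  assumes "(\<lambda>i. (u i)\<^sup>2) summable_on UNIV" and "(\<lambda>i. (v i)\<^sup>2) summable_on UNIV"
  shows "(\<lambda>i. u i * v i) summable_on UNIV"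
proof -
  have s: "(\<lambda>i. (u i)\<^sup>2 + (v i)\<^sup>2) summable_on UNIV"
    by (intro summable_on_add assms)
  have le: "norm (u i * v i) \<le> (u i)\<^sup>2 + (v i)\<^sup>2" for i
  proof -
    have "2 * \<bar>u i\<bar> * \<bar>v i\<bar> \<le> (u i)\<^sup>2 + (v i)\<^sup>2"
      using sum_squares_bound[of "\<bar>u i\<bar>" "\<bar>v i\<bar>"] by simp
    moreover have "0 \<le> \<bar>u i\<bar> * \<bar>v i\<bar>"
      by simp
    ultimately have "\<bar>u i\<bar> * \<bar>v i\<bar> \<le> (u i)\<^sup>2 + (v i)\<^sup>2"
      by linarith
    then show ?thesis
      by (simp add: abs_mult)
  qed
  have "(\<lambda>i. norm (u i * v i)) summable_on UNIV"
    by (rule summable_on_comparison_test[OF s]) (use le in auto)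
  then show ?thesis
    by (rule abs_summable_summable)
qed

lemma square_summable_add:
  fixes u v :: "int \<Rightarrow> real"
  assumes "(\<lambda>i. (u i)\<^sup>2) summable_on UNIV" and "(\<lambda>i. (v i)\<^sup>2) summable_on UNIV"
  shows "(\<lambda>i. (u i + v i)\<^sup>2) summable_on UNIV"
proof -
  have "(\<lambda>i. (u i)\<^sup>2 + (v i)\<^sup>2 + 2 * (u i * v i)) summable_on UNIV"
    by (intro summable_on_add assms summable_on_cmult_right square_summable_prod)
  then show ?thesis
    by (simp add: power2_sum mult.assoc)
qed

lemma square_summable_scale:
  fixes u :: "int \<Rightarrow> real"
  assumes "(\<lambda>i. (u i)\<^sup>2) summable_on UNIV"
  shows "(\<lambda>i. (r * u i)\<^sup>2) summable_on UNIV"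
  using summable_on_cmult_right[OF assms, of "r\<^sup>2"] by (simp add: power_mult_distrib)

instantiation ell2 :: real_vector
begin

lift_definition zero_ell2 :: ell2 is "\<lambda>_. 0"
  by simp

lift_definition plus_ell2 :: "ell2 \<Rightarrow> ell2 \<Rightarrow> ell2" is "\<lambda>u v i. u i + v i"
  by (rule square_summable_add)

lift_definition uminus_ell2 :: "ell2 \<Rightarrow> ell2" is "\<lambda>u i. - u i"
  by simp

lift_definition minus_ell2 :: "ell2 \<Rightarrow> ell2 \<Rightarrow> ell2" is "\<lambda>u v i. u i - v i"
  subgoal for u v
    using square_summable_add[of u "\<lambda>i. - v i"] by simp
  done

lift_definition scaleR_ell2 :: "real \<Rightarrow> ell2 \<Rightarrow> ell2" is "\<lambda>r u i. r * u i"
  by (rule square_summable_scale)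

instance
proof
  fix r s :: real and u v w :: ell2
  show "u + v + w = u + (v + w)" "u + v = v + u" "0 + u = u" "- u + u = 0" "u - v = u + - v"
    by (transfer; simp add: algebra_simps)+
  show "r *\<^sub>R (u + v) = r *\<^sub>R u + r *\<^sub>R v" "(r + s) *\<^sub>R u = r *\<^sub>R u + s *\<^sub>R u"
    "r *\<^sub>R s *\<^sub>R u = (r * s) *\<^sub>R u" "1 *\<^sub>R u = u"
    by (transfer; simp add: algebra_simps)+
qed

end

instantiation ell2 :: real_inner
begin

definition inner_ell2 :: "ell2 \<Rightarrow> ell2 \<Rightarrow> real"
  where "inner_ell2 u v = (\<Sum>\<^sub>\<infinity>i. coord u i * coord v i)"

definition norm_ell2 :: "ell2 \<Rightarrow> real"
  where "norm_ell2 u = sqrt (inner u u)"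

definition sgn_ell2 :: "ell2 \<Rightarrow> ell2"
  where "sgn_ell2 u = u /\<^sub>R norm u"

definition dist_ell2 :: "ell2 \<Rightarrow> ell2 \<Rightarrow> real"
  where "dist_ell2 u v = norm (u - v)"

definition uniformity_ell2 :: "(ell2 \<times> ell2) filter"
  where "uniformity_ell2 = (INF e\<in>{0 <..}. principal {(u, v). dist u v < e})"

definition open_ell2 :: "ell2 set \<Rightarrow> bool"
  where "open_ell2 U \<longleftrightarrow> (\<forall>x\<in>U. eventually (\<lambda>(x', y). x' = x \<longrightarrow> y \<in> U) uniformity)"

instance
proof
  fix r :: real and u v w :: ell2
  note sm = square_summable_prod[OF coord_square_summable coord_square_summable]
  show "dist u v = norm (u - v)" "sgn u = u /\<^sub>R norm u" "norm u = sqrt (inner u u)"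
    by (simp_all only: dist_ell2_def sgn_ell2_def norm_ell2_def)
  show "(uniformity :: (ell2 \<times> ell2) filter) = (INF e\<in>{0 <..}. principal {(u, v). dist u v < e})"
    by (rule uniformity_ell2_def)
  show "open U \<longleftrightarrow> (\<forall>x\<in>U. eventually (\<lambda>(x', y). x' = x \<longrightarrow> y \<in> U) uniformity)" for U :: "ell2 set"
    by (rule open_ell2_def)
  show "inner u v = inner v u"
    by (simp add: inner_ell2_def mult.commute)
  show "inner (u + v) w = inner u w + inner v w"
    by (simp add: inner_ell2_def plus_ell2.rep_eq distrib_right infsum_add[OF sm sm])
  show "inner (r *\<^sub>R u) v = r * inner u v"
    by (simp add: inner_ell2_def scaleR_ell2.rep_eq mult.assoc infsum_cmult_right')
  show "0 \<le> inner u u"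
    by (simp add: inner_ell2_def infsum_nonneg)
  show "inner u u = 0 \<longleftrightarrow> u = 0"
  proof
    assume *: "inner u u = 0"
    have "coord u i * coord u i = 0" for i
      by (rule nonneg_infsum_le_0D[of "\<lambda>i. coord u i * coord u i" UNIV])
        (use * sm[of u u] in \<open>auto simp: inner_ell2_def\<close>)
    then show "u = 0"
      by (intro ell2_eqI) (simp add: zero_ell2.rep_eq)
  qed (simp add: inner_ell2_def zero_ell2.rep_eq)
qed

end

lift_definition unit_seq :: "int \<Rightarrow> ell2" is "\<lambda>j i. if i = j then 1 else 0"
  subgoal for j
    using summable_on_cong_neutral[of UNIV "{j}" "\<lambda>i. (if i = j then 1 else 0 :: real)\<^sup>2" "\<lambda>_. 1"]
    by auto
  done

definition supp :: "ell2 \<Rightarrow> int set"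
  where "supp u = {i. coord u i \<noteq> 0}"

definition ell0 :: "ell2 set"
  where "ell0 = {u. finite (supp u)}"

text \<open>The $\ell^1$-norm with values in $[0,\infty]$; it is $\infty$ off $\ell^1$.\<close>

definition ell1_norm :: "ell2 \<Rightarrow> ereal"
  where "ell1_norm u = (\<Sum>\<^sub>\<infinity>i. ereal \<bar>coord u i\<bar>)"

text \<open>The operator norm of \<open>A\<close> on the subspace \<open>V\<close>, with the $\ell^1$-norm on domain and target.\<close>

definition ell1_opnorm :: "ell2 set \<Rightarrow> (ell2 \<Rightarrow> ell2) \<Rightarrow> ereal"
  where "ell1_opnorm V A = (SUP u\<in>{u \<in> V. ell1_norm u \<le> 1}. ell1_norm (A u))"

definition proj :: "int set \<Rightarrow> ell2 \<Rightarrow> ell2"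
  where "proj J u = (\<Sum>\<^sub>\<infinity>j\<in>J. coord u j *\<^sub>R unit_seq j)"


section \<open>Operators\<close>

definition FBI :: "(ell2 \<Rightarrow> 'h::real_inner) \<Rightarrow> bool"
  where "FBI K \<longleftrightarrow> (\<forall>J. finite J \<longrightarrow> inj_on K (span (unit_seq ` J)))"

text \<open>
  The Moore--Penrose pseudoinverse is the linear extension of the inverse of
  $B|_{\ker(B)^\perp} : \ker(B)^\perp \to \operatorname{ran}(B)$ to
  $\operatorname{ran}(B) \oplus \operatorname{ran}(B)^\perp$ that vanishes on
  $\operatorname{ran}(B)^\perp$. Thus \<open>x = pinv B y\<close> is the element of $\ker(B)^\perp$ for which
  $Bx$ is the component of \<open>y\<close> in $\operatorname{ran}(B)$. Outside
  $\operatorname{ran}(B) \oplus \operatorname{ran}(B)^\perp$ the value is unspecified; that sum is the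
  whole space if \<open>B\<close> has finite rank.
\<close>

definition pinv :: "('a::real_inner \<Rightarrow> 'b::real_inner) \<Rightarrow> 'b \<Rightarrow> 'a"
  where "pinv B y = (THE x. x \<in> {z. B z = 0}\<^sup>\<bottom> \<and> y - B x \<in> (range B)\<^sup>\<bottom>)"

definition gram :: "(ell2 \<Rightarrow> 'h::real_inner) \<Rightarrow> int set \<Rightarrow> ell2 \<Rightarrow> ell2"
  where "gram K I = proj I \<circ> adjoint K \<circ> K \<circ> proj I"

text \<open>The inverse of \<open>gram K I\<close> regarded as an operator on $\operatorname{span}\{e_i : i \in I\}$.\<close>

definition gram_inv :: "(ell2 \<Rightarrow> 'h::real_inner) \<Rightarrow> int set \<Rightarrow> ell2 \<Rightarrow> ell2"
  where "gram_inv K I = inv_into (span (unit_seq ` I)) (gram K I)"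

definition tikhonov :: "(ell2 \<Rightarrow> 'h::real_inner) \<Rightarrow> 'h \<Rightarrow> real \<Rightarrow> ell2 \<Rightarrow> ereal"
  where "tikhonov K g \<alpha> u = ereal (1 / 2 * (norm (K u - g))\<^sup>2) + ereal \<alpha> * ell1_norm u"


section \<open>Quantities in the recovery condition\<close>

text \<open>
  The suprema are taken in the extended reals, so no boundedness side condition is needed for them to
  be meaningful. They are finite whenever \<open>K\<close> is bounded with the FBI property and \<open>I\<close> is finite.
\<close>

definition noise_level :: "(ell2 \<Rightarrow> 'h::real_inner) \<Rightarrow> 'h \<Rightarrow> ereal"
  where "noise_level K \<eta> = (SUP i. ereal \<bar>inner \<eta> (K (unit_seq i))\<bar>)"

definition min_coeff :: "ell2 \<Rightarrow> ereal"
  where "min_coeff u = ereal (Min ((\<lambda>i. \<bar>coord u i\<bar>) ` supp u))"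

definition noise_to_signal :: "(ell2 \<Rightarrow> 'h::real_inner) \<Rightarrow> ell2 \<Rightarrow> 'h \<Rightarrow> ereal"
  where "noise_to_signal K u \<eta> = noise_level K \<eta> / min_coeff u"

definition recovery_sup :: "(ell2 \<Rightarrow> 'h::real_inner) \<Rightarrow> int set \<Rightarrow> ereal"
  where "recovery_sup K I = (SUP i\<in>- I. ell1_norm (pinv (K \<circ> proj I) (K (unit_seq i))))"

definition gram_inv_norm :: "(ell2 \<Rightarrow> 'h::real_inner) \<Rightarrow> int set \<Rightarrow> ereal"
  where "gram_inv_norm K I = ell1_opnorm (span (unit_seq ` I)) (gram_inv K I)"

end

theory Submission
  imports Defs
begin

text \<open>
  A penalty level in the stated window is large enough to keep every minimizer off the complement of the
  support $I$ and small enough not to erase any entry on $I$. The two requirements are handled by separate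
  arguments.

  \<^emph>\<open>No entries outside $I$\<close> (\<open>minimizer_supp_subset\<close>). Let $N$ be the noise level, $S<1$ the recovery
  supremum and $v$ a minimizer. Replace $v$ by $Lv=(KP_I)^{\dagger}Kv$. This keeps the entries of $v$ on $I$ and
  trades each $e_i$ with $i\notin I$ for $(KP_I)^{\dagger}Ke_i$, a vector supported in $I$ of $\ell^1$-norm at
  most $S$. The penalty thus drops by at least $\alpha(1-S)$ per unit of mass outside $I$. The image $KLv$ is the
  orthogonal projection of $Kv$, and the noise-free data lie in the range of that projection, so the discrepancy
  term can grow only through the noise: by at most $|\langle Ke_i-K(KP_I)^{\dagger}Ke_i,\eta\rangle|\le(1+S)N$
  per unit of mass. The lower bound on $\alpha$ says $(1+S)N<\alpha(1-S)$, so mass outside $I$ contradicts minimality.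

  \<^emph>\<open>No missing entries on $I$\<close> (\<open>coefficient_error\<close>). The first-order condition bounds every
  $\langle Kv-g,Ke_j\rangle$ by $\alpha$, hence every $\langle K(u-v),Ke_j\rangle$ by $\alpha+N$. Now that $u-v$ is
  supported in $I$, these pairings determine it through the inverse Gram matrix, whose symmetry lets its
  $\ell^1$-operator norm $G$ act as an operator norm for the supremum norm. The result is
  $|u_k-v_k|\le(\alpha+N)G$, which by the upper bound on $\alpha$ is less than $\min_{i\in I}|u_i|$.

  The hypothesis is exactly the condition for the window to be nonempty: adding $N$ to both of its ends turns
  the required inequality into $2N/(1-S)<\min_{i\in I}|u_i|/G$.
\<close>

section \<open>Coordinates and the $\ell^1$-norm\<close>

lemma coord_simps [simp]:
  "coord 0 i = 0" "coord (x + y) i = coord x i + coord y i" "coord (x - y) i = coord x i - coord y i"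
  "coord (- x) i = - coord x i" "coord (r *\<^sub>R x) i = r * coord x i"
  by (simp_all add: zero_ell2.rep_eq plus_ell2.rep_eq minus_ell2.rep_eq uminus_ell2.rep_eq
      scaleR_ell2.rep_eq)

lemma coord_unit_seq: "coord (unit_seq j) i = (if i = j then 1 else 0)"
  by (simp add: unit_seq.rep_eq)

lemma coord_sum: "coord (sum f A) i = (\<Sum>a\<in>A. coord (f a) i)"
  by (induction A rule: infinite_finite_induct) simp_all

lemma inner_unit_seq: "inner x (unit_seq j) = coord x j"
proof -
  have "((\<lambda>i. coord x i * coord (unit_seq j) i) has_sum coord x j) UNIV"
    by (rule has_sum_finite_neutralI[of "{j}"]) (auto simp: coord_unit_seq)
  then show ?thesis
    unfolding inner_ell2_def by (rule infsumI)
qed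

lemma bounded_linear_coord: "bounded_linear (\<lambda>x. coord x i)"
  using bounded_linear_inner_left[of "unit_seq i"] by (simp add: inner_unit_seq)

lemma coord_combination:
  assumes "finite I"
  shows "coord (\<Sum>j\<in>I. c j *\<^sub>R unit_seq j) i = (if i \<in> I then c i else 0)"
  using assms by (simp add: coord_sum coord_unit_seq if_distrib[of "\<lambda>t. _ * t"] sum.delta cong: if_cong)

lemma inner_combination: "inner x (\<Sum>j\<in>I. c j *\<^sub>R unit_seq j) = (\<Sum>j\<in>I. c j * coord x j)"
  by (simp add: inner_sum_right inner_unit_seq)

lemma inner_combination_self:
  assumes "finite I"
  shows "inner (\<Sum>j\<in>I. c j *\<^sub>R unit_seq j) (\<Sum>j\<in>I. c j *\<^sub>R unit_seq j) = (\<Sum>j\<in>I. (c j)\<^sup>2)"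
  using assms
  by (auto simp: inner_combination coord_combination power2_eq_square intro!: sum.cong)

text \<open>
  By Pythagoras, the squared distance from \<open>x\<close> to a finite partial sum is the tail of the
  convergent series of squared coordinates.
\<close>

lemma has_sum_unit_seq: "((\<lambda>j. coord x j *\<^sub>R unit_seq j) has_sum x) UNIV"
proof -
  define P where "P F = (\<Sum>j\<in>F. coord x j *\<^sub>R unit_seq j)" for F
  have sq: "(norm (x - P F))\<^sup>2 = (\<Sum>\<^sub>\<infinity>i. (coord x i)\<^sup>2) - (\<Sum>i\<in>F. (coord x i)\<^sup>2)" if F: "finite F" for F
  proof -
    have xx: "inner x x = (\<Sum>\<^sub>\<infinity>i. (coord x i)\<^sup>2)"
      by (simp add: inner_ell2_def power2_eq_square)
    have xP: "inner x (P F) = (\<Sum>i\<in>F. (coord x i)\<^sup>2)"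
      by (simp add: P_def inner_combination power2_eq_square)
    have PP: "inner (P F) (P F) = (\<Sum>i\<in>F. (coord x i)\<^sup>2)"
      using F unfolding P_def by (rule inner_combination_self)
    show ?thesis
      unfolding power2_norm_eq_inner
      by (simp add: inner_diff_left inner_diff_right xx xP PP inner_commute[of "P F" x])
  qed
  have "((\<lambda>i. (coord x i)\<^sup>2) has_sum (\<Sum>\<^sub>\<infinity>i. (coord x i)\<^sup>2)) UNIV"
    by (rule has_sum_infsum[OF coord_square_summable])
  then have lim: "((\<lambda>F. (\<Sum>\<^sub>\<infinity>i. (coord x i)\<^sup>2) - (\<Sum>i\<in>F. (coord x i)\<^sup>2)) \<longlongrightarrow>
      (\<Sum>\<^sub>\<infinity>i. (coord x i)\<^sup>2) - (\<Sum>\<^sub>\<infinity>i. (coord x i)\<^sup>2)) (finite_subsets_at_top UNIV)"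
    unfolding has_sum_def by (intro tendsto_diff tendsto_const)
  have "eventually (\<lambda>F. (\<Sum>\<^sub>\<infinity>i. (coord x i)\<^sup>2) - (\<Sum>i\<in>F. (coord x i)\<^sup>2) = (norm (x - P F))\<^sup>2)
      (finite_subsets_at_top UNIV)"
    by (rule eventually_finite_subsets_at_top_weakI) (simp add: sq)
  from Lim_transform_eventually[OF lim this]
  have "((\<lambda>F. (norm (x - P F))\<^sup>2) \<longlongrightarrow> 0) (finite_subsets_at_top UNIV)"
    by simp
  then have "((\<lambda>F. sqrt ((norm (x - P F))\<^sup>2)) \<longlongrightarrow> sqrt 0) (finite_subsets_at_top UNIV)"
    by (rule tendsto_real_sqrt)
  then have "((\<lambda>F. norm (P F - x)) \<longlongrightarrow> 0) (finite_subsets_at_top UNIV)"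
    by (simp add: norm_minus_commute)
  then have "((\<lambda>F. P F - x) \<longlongrightarrow> 0) (finite_subsets_at_top UNIV)"
    by (rule tendsto_norm_zero_cancel)
  then show ?thesis
    unfolding has_sum_def P_def by (simp add: LIM_zero_iff)
qed

text \<open>
  The form in which the density of finite sequences is used: a bounded operator is determined by, and
  can be estimated through, its values on the standard basis.
\<close>

lemma has_sum_bounded_linear_unit_seq:
  fixes f :: "ell2 \<Rightarrow> 'b::real_normed_vector"
  assumes "bounded_linear f"
  shows "((\<lambda>i. coord x i *\<^sub>R f (unit_seq i)) has_sum f x) UNIV"
proof -
  interpret bounded_linear f by fact
  show ?thesis
    using has_sum_bounded_linear[OF assms has_sum_unit_seq[of x]] by (simp add: scaleR)
qed

lemma ell1_norm_nonneg: "0 \<le> ell1_norm x"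
  unfolding ell1_norm_def by (rule infsum_nonneg) simp

text \<open>
  The series defining the $\ell^1$-norm is taken in $[0,\infty]$. This lemma and the next allow all
  estimates to be done with real-valued series, finiteness of the norm being the same as summability.
\<close>

lemma ell1_norm_summable:
  assumes "(\<lambda>i. \<bar>coord x i\<bar>) summable_on UNIV"
  shows "ell1_norm x = ereal (\<Sum>\<^sub>\<infinity>i. \<bar>coord x i\<bar>)"
  unfolding ell1_norm_def
  by (subst infsum_nonneg_is_SUPREMUM_ereal[OF assms], simp)
    (simp add: nonneg_infsum_complete)

lemma ell1_norm_finite_imp_summable:
  assumes "ell1_norm x \<noteq> \<infinity>"
  shows "(\<lambda>i. \<bar>coord x i\<bar>) summable_on UNIV"
proof (rule nonneg_bdd_above_summable_on)
  obtain r where r: "ell1_norm x = ereal r"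
    using assms ell1_norm_nonneg[of x] by (cases "ell1_norm x") auto
  have "ereal (\<Sum>i\<in>F. \<bar>coord x i\<bar>) \<le> ell1_norm x" if "finite F" for F
    unfolding ell1_norm_def
    by (subst nonneg_infsum_complete) (use that in \<open>auto intro!: SUP_upper2[of F]\<close>)
  then show "bdd_above (sum (\<lambda>i. \<bar>coord x i\<bar>) ` {F. F \<subseteq> UNIV \<and> finite F})"
    by (intro bdd_aboveI[of _ r]) (auto simp: r)
qed simp

lemma supp_subset_iff: "supp x \<subseteq> I \<longleftrightarrow> (\<forall>i. i \<notin> I \<longrightarrow> coord x i = 0)"
  by (auto simp: supp_def)

lemma has_sum_abs_coord_finite:
  assumes "finite I" "supp x \<subseteq> I"
  shows "((\<lambda>i. \<bar>coord x i\<bar>) has_sum (\<Sum>i\<in>I. \<bar>coord x i\<bar>)) UNIV"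
  by (rule has_sum_finite_neutralI[of I]) (use assms in \<open>auto simp: supp_def\<close>)

lemma ell1_norm_finite_supp:
  assumes "finite I" "supp x \<subseteq> I"
  shows "ell1_norm x = ereal (\<Sum>i\<in>I. \<bar>coord x i\<bar>)"
  using has_sum_abs_coord_finite[OF assms]
  by (subst ell1_norm_summable) (auto simp: infsumI summable_on_def)

lemma supp_unit_seq: "supp (unit_seq j) = {j}"
  by (auto simp: supp_def coord_unit_seq)

lemma supp_combination:
  assumes "finite I" "supp x \<subseteq> I"
  shows "x = (\<Sum>j\<in>I. coord x j *\<^sub>R unit_seq j)"
  using assms by (intro ell2_eqI) (auto simp: coord_combination supp_def)

lemma span_unit_seq:
  assumes "finite I"
  shows "span (unit_seq ` I) = {x. supp x \<subseteq> I}"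
proof safe
  fix x i assume x: "x \<in> span (unit_seq ` I)" and i: "i \<in> supp x"
  have "subspace {x. supp x \<subseteq> I}"
    by (simp add: subspace_def supp_subset_iff)
  moreover have "unit_seq ` I \<subseteq> {x. supp x \<subseteq> I}"
    by (auto simp: supp_unit_seq)
  ultimately show "i \<in> I"
    using x i span_minimal by blast
next
  fix x assume "supp x \<subseteq> I"
  then have "x = (\<Sum>j\<in>I. coord x j *\<^sub>R unit_seq j)"
    using assms by (rule supp_combination[rotated])
  also have "\<dots> \<in> span (unit_seq ` I)"
    by (intro span_sum span_scale span_base) auto
  finally show "x \<in> span (unit_seq ` I)" .
qed

lemma coord_proj:
  assumes "finite I"
  shows "coord (proj I x) i = (if i \<in> I then coord x i else 0)"
  using assms by (simp add: proj_def coord_combination)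

lemma proj_eq_self:
  assumes "finite I" "supp x \<subseteq> I"
  shows "proj I x = x"
  using assms by (auto intro!: ell2_eqI simp: coord_proj supp_def)

text \<open>
  The constant \<open>adjoint\<close> is a choice among all operators satisfying the adjoint identity, so
  one such operator has to be exhibited. The coordinates of $K^*y$ can only be
  $c_i = \langle Ke_i, y\rangle$. They are square summable because testing $y$ against the image of the
  truncation $z = \sum_{i\in F} c_i e_i$ gives
  $\sum_F c_i^2 = \langle Kz, y\rangle \le C \|y\| (\sum_F c_i^2)^{1/2}$.
\<close>

lemma inner_adjoint:
  fixes K :: "ell2 \<Rightarrow> 'h::real_inner"
  assumes K: "bounded_linear K"
  shows "inner (K x) y = inner x (adjoint K y)"
proof -
  interpret bounded_linear K by fact
  have "\<exists>w. \<forall>x. inner (K x) y = inner x w" for y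
  proof -
    let ?c = "\<lambda>i. inner (K (unit_seq i)) y"
    obtain C where C: "0 \<le> C" "\<And>x. norm (K x) \<le> C * norm x"
      using nonneg_bounded by (auto simp: mult.commute)
    have bound: "(\<Sum>i\<in>F. (?c i)\<^sup>2) \<le> (C * norm y)\<^sup>2" if F: "finite F" for F
    proof -
      let ?z = "\<Sum>i\<in>F. ?c i *\<^sub>R unit_seq i" and ?s = "\<Sum>i\<in>F. (?c i)\<^sup>2"
      have s0: "0 \<le> ?s"
        by (simp add: sum_nonneg)
      have s: "?s = inner (K ?z) y"
        by (simp add: sum scaleR inner_sum_left power2_eq_square)
      have z: "norm ?z = sqrt ?s"
        unfolding norm_eq_sqrt_inner inner_combination_self[OF F] ..
      have "?s \<le> norm (K ?z) * norm y"
        unfolding s by (rule norm_cauchy_schwarz)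
      also have "\<dots> \<le> C * norm ?z * norm y"
        by (intro mult_right_mono C) simp
      finally have "sqrt ?s * sqrt ?s \<le> (C * norm y) * sqrt ?s"
        using s0 by (simp add: z mult_ac)
      moreover have "0 \<le> C * norm y"
        using C(1) by simp
      ultimately have "sqrt ?s \<le> C * norm y"
        using real_sqrt_ge_zero[OF s0]
        by (cases "sqrt ?s = 0") (simp only:, use mult_le_cancel_right[of "sqrt ?s" "sqrt ?s" "C * norm y"] in linarith)
      then have "(sqrt ?s)\<^sup>2 \<le> (C * norm y)\<^sup>2"
        using s0 by (intro power_mono) auto
      then show ?thesis
        using s0 by simp
    qed
    have "(\<lambda>i. (?c i)\<^sup>2) summable_on UNIV"
      by (rule nonneg_bdd_above_summable_on) (auto intro!: bdd_aboveI[of _ "(C * norm y)\<^sup>2"] bound)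
    then have w: "coord (Abs_ell2 ?c) = ?c"
      by (intro Abs_ell2_inverse) simp
    have "inner (K x) y = inner x (Abs_ell2 ?c)" for x
    proof -
      have "bounded_linear (\<lambda>x. inner (K x) y)"
        using bounded_linear_compose[OF bounded_linear_inner_left K] by (simp add: o_def)
      from has_sum_bounded_linear_unit_seq[OF this, of x]
      show ?thesis
        by (simp add: inner_ell2_def w infsumI)
    qed
    then show ?thesis by blast
  qed
  then have "\<exists>f'. \<forall>x y. inner (K x) y = inner x (f' y)"
    by metis
  then have "\<forall>x y. inner (K x) y = inner x (adjoint K y)"
    unfolding adjoint_def by (rule someI_ex)
  then show ?thesis by blast
qed

text \<open>
  The duality of $\ell^1$ and $\ell^\infty$ in a strict form: a single coordinate at which the functional
  misses the bound makes the whole pairing strictly smaller.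
\<close>

lemma functional_less_ell1:
  fixes \<Phi> :: "ell2 \<Rightarrow> real"
  assumes \<Phi>: "bounded_linear \<Phi>"
    and v: "(\<lambda>i. \<bar>coord v i\<bar>) summable_on UNIV"
    and le: "\<And>i. \<bar>\<Phi> (unit_seq i)\<bar> \<le> \<alpha>"
    and k: "coord v k \<noteq> 0" "\<bar>\<Phi> (unit_seq k)\<bar> < \<alpha>"
  shows "\<Phi> v < \<alpha> * (\<Sum>\<^sub>\<infinity>i. \<bar>coord v i\<bar>)"
proof (rule has_sum_strict_mono)
  show "((\<lambda>i. coord v i *\<^sub>R \<Phi> (unit_seq i)) has_sum \<Phi> v) UNIV"
    by (rule has_sum_bounded_linear_unit_seq[OF \<Phi>])
  show "((\<lambda>i. \<alpha> * \<bar>coord v i\<bar>) has_sum \<alpha> * (\<Sum>\<^sub>\<infinity>i. \<bar>coord v i\<bar>)) UNIV"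
    by (intro has_sum_cmult_right has_sum_infsum v)
  have *: "coord v i *\<^sub>R \<Phi> (unit_seq i) \<le> \<bar>\<Phi> (unit_seq i)\<bar> * \<bar>coord v i\<bar>" for i
    by (metis abs_ge_self abs_mult mult.commute real_scaleR_def)
  show "coord v i *\<^sub>R \<Phi> (unit_seq i) \<le> \<alpha> * \<bar>coord v i\<bar>" for i
    using * le by (meson abs_ge_zero mult_right_mono order_trans)
  show "coord v k *\<^sub>R \<Phi> (unit_seq k) < \<alpha> * \<bar>coord v k\<bar>"
    using *[of k] k by (smt (verit) mult_strict_right_mono)
qed simp

section \<open>The Gram operator and the dual system\<close>

text \<open>
  Everything that depends on \<open>K\<close> and \<open>I\<close> only, not on the data. The finite set
  \<open>I\<close> will be the support of the sequence to be recovered.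
\<close>

locale finite_support_problem =
  fixes K :: "ell2 \<Rightarrow> 'h::real_inner" and I :: "int set"
  assumes bounded_linear_K: "bounded_linear K" and FBI_K: "FBI K" and finite_I: "finite I"
begin

sublocale bounded_linear K
  by (rule bounded_linear_K)

lemma inner_K_expand:
  assumes "supp x \<subseteq> I"
  shows "inner y (K x) = (\<Sum>j\<in>I. coord x j * inner y (K (unit_seq j)))"
  by (subst supp_combination[OF finite_I assms]) (simp add: sum scaleR inner_sum_right)

text \<open>
  If $Kx$ is orthogonal to every $Ke_j$ with $j\in I$ and $x$ is supported in $I$, then $Kx$ is orthogonal
  to itself, and the FBI property gives $x=0$. All uniqueness arguments below reduce to this.
\<close>

lemma normal_equations_unique:
  assumes "supp x \<subseteq> I" and "\<And>j. j \<in> I \<Longrightarrow> inner (K x) (K (unit_seq j)) = 0"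
  shows "x = 0"
proof -
  have "inner (K x) (K x) = 0"
    using assms(2) by (simp add: inner_K_expand[OF assms(1), of "K x"])
  then have "K x = K 0"
    by (simp add: zero)
  moreover have "inj_on K (span (unit_seq ` I))"
    using FBI_K finite_I by (simp add: FBI_def)
  moreover have "x \<in> span (unit_seq ` I)"
    using assms(1) span_unit_seq[OF finite_I] by simp
  ultimately show ?thesis
    using inj_onD[of K _ x 0] span_zero by blast
qed

lemma coord_gram:
  "coord (gram K I x) i = (if i \<in> I then inner (K (proj I x)) (K (unit_seq i)) else 0)"
proof -
  have "coord (adjoint K y) i = inner y (K (unit_seq i))" for y
    using inner_adjoint[OF bounded_linear_K, of "unit_seq i" y]
    by (metis inner_commute inner_unit_seq)
  then show ?thesis
    by (simp add: gram_def coord_proj[OF finite_I])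
qed

lemma supp_gram: "supp (gram K I x) \<subseteq> I"
  by (auto simp: supp_def coord_gram)

lemma linear_gram: "linear (gram K I)"
proof (rule linearI)
  have p: "proj I (x + y) = proj I x + proj I y" "proj I (r *\<^sub>R x) = r *\<^sub>R proj I x" for x y r
    by (auto intro!: ell2_eqI simp: coord_proj[OF finite_I])
  show "gram K I (x + y) = gram K I x + gram K I y" "gram K I (r *\<^sub>R x) = r *\<^sub>R gram K I x" for x y r
    by (auto intro!: ell2_eqI simp: coord_gram p add scaleR inner_add_left)
qed

lemma inj_on_gram: "inj_on (gram K I) (span (unit_seq ` I))"
proof (rule inj_onI)
  interpret gram: linear "gram K I"
    by (rule linear_gram)
  fix x y assume xy: "x \<in> span (unit_seq ` I)" "y \<in> span (unit_seq ` I)"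
    and eq: "gram K I x = gram K I y"
  have s: "supp (x - y) \<subseteq> I"
    using span_diff[OF xy] span_unit_seq[OF finite_I] by simp
  have g: "gram K I (x - y) = 0"
    using eq by (simp add: gram.diff)
  have "x - y = 0"
  proof (rule normal_equations_unique[OF s])
    fix j assume "j \<in> I"
    then show "inner (K (x - y)) (K (unit_seq j)) = 0"
      using arg_cong[OF g, of "\<lambda>z. coord z j"] by (simp add: coord_gram proj_eq_self[OF finite_I s])
  qed
  then show "x = y" by simp
qed

text \<open>
  An injective linear map of a finite-dimensional space into itself is onto. The ambient space has infinite
  dimension, so this is argued by counting: the images of the basis vectors are independent and as many as
  the basis vectors, and a basis vector outside their span could be added to give an independent family
  that is too large for the space.
\<close>

lemma span_subset_gram_image: "span (unit_seq ` I) \<subseteq> gram K I ` span (unit_seq ` I)"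
proof -
  let ?E = "unit_seq ` I"
  have E: "independent ?E"
  proof (rule independent_if_scalars_zero)
    fix f x assume 0: "(\<Sum>e\<in>?E. f e *\<^sub>R e) = 0" and "x \<in> ?E"
    then obtain j where j: "j \<in> I" "x = unit_seq j" by auto
    have inj: "inj_on unit_seq I"
      by (rule inj_onI) (metis coord_unit_seq zero_neq_one)
    have "(\<Sum>i\<in>I. f (unit_seq i) *\<^sub>R unit_seq i) = 0"
      using 0 by (simp add: sum.reindex[OF inj])
    from arg_cong[OF this, of "\<lambda>z. coord z j"] show "f x = 0"
      using j by (simp add: coord_combination[OF finite_I])
  qed (simp add: finite_I)
  let ?B = "gram K I ` ?E"
  have B: "independent ?B"
    by (rule linear_independent_injective_image[OF linear_gram E inj_on_gram])
  have card: "card ?B = card ?E"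
    by (intro card_image inj_on_subset[OF inj_on_gram]) (rule span_superset)
  have sub: "?B \<subseteq> span ?E"
    using supp_gram by (auto simp: span_unit_seq[OF finite_I])
  have "e \<in> span ?B" if e: "e \<in> ?E" for e
  proof (rule ccontr)
    assume not: "e \<notin> span ?B"
    then have "independent (insert e ?B)"
      using B by (rule independent_insertI)
    moreover have "insert e ?B \<subseteq> span ?E"
      using sub span_base[OF e] by simp
    moreover have "finite ?E" "finite ?B"
      by (simp_all add: finite_I)
    ultimately have "card (insert e ?B) \<le> card ?E"
      using independent_span_bound by metis
    moreover have "e \<notin> ?B"
      using not span_base[of e ?B] by argo
    ultimately show False
      using card card_insert_disjoint[OF \<open>finite ?B\<close>, of e] by linarith
  qed
  then have "span ?E \<subseteq> span ?B"
    by (intro span_minimal) auto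
  then show ?thesis
    by (simp add: linear_span_image[OF linear_gram])
qed

lemma gram_inv:
  assumes "supp y \<subseteq> I"
  shows supp_gram_inv: "supp (gram_inv K I y) \<subseteq> I"
    and gram_gram_inv: "gram K I (gram_inv K I y) = y"
proof -
  have y: "y \<in> gram K I ` span (unit_seq ` I)"
    using assms span_subset_gram_image span_unit_seq[OF finite_I] by auto
  show "supp (gram_inv K I y) \<subseteq> I"
    using inv_into_into[OF y] by (simp add: gram_inv_def span_unit_seq[OF finite_I])
  show "gram K I (gram_inv K I y) = y"
    using f_inv_into_f[OF y] by (simp add: gram_inv_def)
qed

text \<open>
  The columns of $(P_IK^*KP_I)^{-1}$. Since $\langle Kb_j, Ke_k\rangle = \delta_{jk}$ for $j,k\in I$,
  pairing with $Kb_j$ extracts the $j$-th coordinate of a vector from its image under $K$.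
\<close>

definition dual :: "int \<Rightarrow> ell2"
  where "dual j = gram_inv K I (unit_seq j)"

lemma supp_dual: "j \<in> I \<Longrightarrow> supp (dual j) \<subseteq> I"
  unfolding dual_def by (rule supp_gram_inv) (simp add: supp_unit_seq)

lemma dual_biorthogonal:
  assumes "j \<in> I" "k \<in> I"
  shows "inner (K (dual j)) (K (unit_seq k)) = (if k = j then 1 else 0)"
proof -
  have "gram K I (dual j) = unit_seq j"
    unfolding dual_def by (rule gram_gram_inv) (use assms in \<open>simp add: supp_unit_seq\<close>)
  from arg_cong[OF this, of "\<lambda>z. coord z k"] show ?thesis
    using assms by (simp add: coord_gram proj_eq_self[OF finite_I supp_dual] coord_unit_seq)
qed

lemma supp_dual_combination: "supp (\<Sum>j\<in>I. c j *\<^sub>R dual j) \<subseteq> I"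
proof -
  have "coord (dual j) i = 0" if "j \<in> I" "i \<notin> I" for i j
    using supp_dual[OF that(1)] that(2) by (auto simp: supp_def)
  then have "coord (\<Sum>j\<in>I. c j *\<^sub>R dual j) i = 0" if "i \<notin> I" for i
    using that by (simp add: coord_sum)
  then show ?thesis
    unfolding supp_def by blast
qed

lemma inner_K_dual_combination:
  assumes "k \<in> I"
  shows "inner (K (\<Sum>j\<in>I. c j *\<^sub>R dual j)) (K (unit_seq k)) = c k"
  using assms finite_I
  by (simp add: sum scaleR inner_sum_left dual_biorthogonal if_distrib[of "\<lambda>t. _ * t"] cong: if_cong)

text \<open>
  The solution of the normal equations with right-hand side \<open>c\<close>, in terms of the dual system.
\<close>

lemma eq_dual_combination:
  assumes "supp x \<subseteq> I" and "\<And>k. k \<in> I \<Longrightarrow> inner (K x) (K (unit_seq k)) = c k"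
  shows "x = (\<Sum>j\<in>I. c j *\<^sub>R dual j)"
proof -
  have "x - (\<Sum>j\<in>I. c j *\<^sub>R dual j) = 0"
  proof (rule normal_equations_unique)
    show "supp (x - (\<Sum>j\<in>I. c j *\<^sub>R dual j)) \<subseteq> I"
      using assms(1) supp_dual_combination[of c] by (simp add: supp_subset_iff)
    show "inner (K (x - (\<Sum>j\<in>I. c j *\<^sub>R dual j))) (K (unit_seq k)) = 0" if "k \<in> I" for k
      using that by (simp add: diff inner_diff_left assms(2) inner_K_dual_combination)
  qed
  then show ?thesis by simp
qed

lemma gram_inv_eq:
  assumes "supp y \<subseteq> I"
  shows "gram_inv K I y = (\<Sum>j\<in>I. coord y j *\<^sub>R dual j)"
proof (rule eq_dual_combination)
  show "supp (gram_inv K I y) \<subseteq> I"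
    by (rule supp_gram_inv[OF assms])
  show "inner (K (gram_inv K I y)) (K (unit_seq k)) = coord y k" if "k \<in> I" for k
    using arg_cong[OF gram_gram_inv[OF assms], of "\<lambda>z. coord z k"] that
    by (simp add: coord_gram proj_eq_self[OF finite_I supp_gram_inv[OF assms]])
qed

text \<open>
  The coefficients of the least squares fit of \<open>y\<close> by the vectors $Ke_j$, $j\in I$; it is identified
  with $(KP_I)^{\dagger}y$ in \<open>pinv_eq_fit\<close>. This explicit formula makes linearity and boundedness
  evident.
\<close>

definition fit :: "'h \<Rightarrow> ell2"
  where "fit y = (\<Sum>j\<in>I. inner y (K (unit_seq j)) *\<^sub>R dual j)"

lemma supp_fit: "supp (fit y) \<subseteq> I"
  unfolding fit_def by (rule supp_dual_combination)

lemma residual_orthogonal: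
  assumes "supp x \<subseteq> I"
  shows "inner (y - K (fit y)) (K x) = 0"
proof -
  have *: "inner (y - K (fit y)) (K (unit_seq j)) = 0" if "j \<in> I" for j
    using that by (simp add: fit_def inner_diff_left inner_K_dual_combination)
  then show ?thesis
    by (simp add: inner_K_expand[OF assms])
qed

lemma fit_K:
  assumes "supp x \<subseteq> I"
  shows "fit (K x) = x"
  using eq_dual_combination[OF assms] unfolding fit_def by simp

text \<open>
  The two conditions that define the pseudoinverse of $KP_I$ say, in this order, that $x$ is supported in
  $I$ (the kernel of $KP_I$ is that of $P_I$, by the FBI property) and that $x$ solves the normal equations.
\<close>

lemma pinv_eq_fit: "pinv (K \<circ> proj I) y = fit y"
  unfolding pinv_def
proof (rule the_equality)
  have p: "supp (proj I z) \<subseteq> I" for z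
    by (auto simp: supp_def coord_proj[OF finite_I])
  have ker: "proj I z = 0" if "K (proj I z) = 0" for z
    by (rule normal_equations_unique[OF p]) (simp add: that)
  show "fit y \<in> {z. (K \<circ> proj I) z = 0}\<^sup>\<bottom> \<and> y - (K \<circ> proj I) (fit y) \<in> (range (K \<circ> proj I))\<^sup>\<bottom>"
  proof
    have "inner z (fit y) = 0" if "proj I z = 0" for z
    proof -
      have "coord z j = 0" if "j \<in> I" for j
        using arg_cong[OF \<open>proj I z = 0\<close>, of "\<lambda>z. coord z j"] that by (simp add: coord_proj[OF finite_I])
      then show ?thesis
        by (subst supp_combination[OF finite_I supp_fit]) (simp add: inner_combination)
    qed
    then show "fit y \<in> {z. (K \<circ> proj I) z = 0}\<^sup>\<bottom>"
      using ker by (auto simp: orthogonal_comp_def orthogonal_def)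
    show "y - (K \<circ> proj I) (fit y) \<in> (range (K \<circ> proj I))\<^sup>\<bottom>"
      using residual_orthogonal[OF p]
      by (auto simp: orthogonal_comp_def orthogonal_def proj_eq_self[OF finite_I supp_fit] inner_commute)
  qed
next
  fix x assume x: "x \<in> {z. (K \<circ> proj I) z = 0}\<^sup>\<bottom> \<and> y - (K \<circ> proj I) x \<in> (range (K \<circ> proj I))\<^sup>\<bottom>"
  have "coord x i = 0" if "i \<notin> I" for i
  proof -
    have "proj I (unit_seq i) = 0"
      using that by (auto intro!: ell2_eqI simp: coord_proj[OF finite_I] coord_unit_seq)
    then have "inner (unit_seq i) x = 0"
      using x by (auto simp: orthogonal_comp_def orthogonal_def zero)
    then show ?thesis
      by (simp add: inner_commute inner_unit_seq)
  qed
  then have s: "supp x \<subseteq> I"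
    by (auto simp: supp_def)
  show "x = fit y"
    unfolding fit_def
  proof (rule eq_dual_combination[OF s])
    fix k assume "k \<in> I"
    then have k: "proj I (unit_seq k) = unit_seq k"
      by (intro proj_eq_self finite_I) (simp add: supp_unit_seq)
    have "inner (K (proj I (unit_seq k))) (y - K (proj I x)) = 0"
      using x unfolding orthogonal_comp_def orthogonal_def by auto
    then show "inner (K x) (K (unit_seq k)) = inner y (K (unit_seq k))"
      by (simp add: k proj_eq_self[OF finite_I s] inner_diff_right inner_commute)
  qed
qed

lemma ell1_norm_dual_le: 
  assumes "k \<in> I"
  shows "ell1_norm (dual k) \<le> gram_inv_norm K I"
proof -
  have "ell1_norm (unit_seq k) \<le> 1"
    using ell1_norm_finite_supp[of "{k}" "unit_seq k"] by (simp add: supp_unit_seq coord_unit_seq)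
  moreover have "unit_seq k \<in> span (unit_seq ` I)"
    using assms by (intro span_base) auto
  ultimately show ?thesis
    unfolding gram_inv_norm_def ell1_opnorm_def dual_def by (intro SUP_upper) simp
qed

text \<open>
  In the unit ball of $\ell^1$ all coordinates are at most $1$ in modulus, so the sum of the
  $\ell^1$-norms of all columns bounds the operator norm. That crude bound suffices for finiteness.
\<close>

lemma gram_inv_norm_finite: "gram_inv_norm K I \<noteq> \<infinity>"
proof -
  let ?C = "\<Sum>j\<in>I. \<Sum>i\<in>I. \<bar>coord (dual j) i\<bar>"
  have "ell1_norm (gram_inv K I y) \<le> ereal ?C"
    if "y \<in> span (unit_seq ` I)" and le: "ell1_norm y \<le> 1" for y
  proof -
    have y: "supp y \<subseteq> I"
      using that span_unit_seq[OF finite_I] by simp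
    have "(\<Sum>i\<in>I. \<bar>coord y i\<bar>) \<le> 1"
      using le ell1_norm_finite_supp[OF finite_I y] by simp
    then have y1: "\<bar>coord y j\<bar> \<le> 1" if "j \<in> I" for j
      using member_le_sum[OF that, of "\<lambda>i. \<bar>coord y i\<bar>"] finite_I by simp
    have "(\<Sum>i\<in>I. \<bar>coord (gram_inv K I y) i\<bar>) \<le> (\<Sum>i\<in>I. \<Sum>j\<in>I. \<bar>coord (dual j) i\<bar>)"
    proof (rule sum_mono)
      fix i
      have "\<bar>coord (gram_inv K I y) i\<bar> \<le> (\<Sum>j\<in>I. \<bar>coord y j * coord (dual j) i\<bar>)"
        by (simp add: gram_inv_eq[OF y] coord_sum sum_abs)
      also have "\<dots> \<le> (\<Sum>j\<in>I. \<bar>coord (dual j) i\<bar>)"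
        using y1 by (intro sum_mono) (simp add: abs_mult mult_left_le_one_le)
      finally show "\<bar>coord (gram_inv K I y) i\<bar> \<le> (\<Sum>j\<in>I. \<bar>coord (dual j) i\<bar>)" .
    qed
    also have "\<dots> = ?C"
      by (rule sum.swap)
    finally show ?thesis
      by (simp add: ell1_norm_finite_supp[OF finite_I supp_gram_inv[OF y]])
  qed
  then have "gram_inv_norm K I \<le> ereal ?C"
    unfolding gram_inv_norm_def ell1_opnorm_def by (intro SUP_least) simp
  then show ?thesis by auto
qed

lemma gram_inv_norm_real:
  assumes "I \<noteq> {}"
  obtains G where "gram_inv_norm K I = ereal G" "0 < G"
    "\<And>k. k \<in> I \<Longrightarrow> (\<Sum>i\<in>I. \<bar>coord (dual k) i\<bar>) \<le> G"
proof -
  obtain k where k: "k \<in> I"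
    using assms by blast
  have "dual k \<noteq> 0"
    using dual_biorthogonal[OF k k] by (auto simp: zero)
  then obtain i where i: "coord (dual k) i \<noteq> 0"
    by (metis coord_simps(1) ell2_eqI)
  then have "i \<in> I"
    using supp_dual[OF k] by (auto simp: supp_def)
  then have pos: "0 < (\<Sum>i\<in>I. \<bar>coord (dual k) i\<bar>)"
    using i finite_I by (intro sum_pos2[of I i]) auto
  have le: "ereal (\<Sum>i\<in>I. \<bar>coord (dual k) i\<bar>) \<le> gram_inv_norm K I" if "k \<in> I" for k
    using ell1_norm_dual_le[OF that] by (simp add: ell1_norm_finite_supp[OF finite_I supp_dual[OF that]])
  obtain G where G: "gram_inv_norm K I = ereal G"
    using gram_inv_norm_finite le[OF k] by (cases "gram_inv_norm K I") auto
  show thesis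
    using that[OF G] le pos k unfolding G by force
qed

end

section \<open>Minimizers of the Tikhonov functional\<close>

lemma tikhonov_summable:
  assumes "(\<lambda>i. \<bar>coord x i\<bar>) summable_on UNIV"
  shows "tikhonov K g \<alpha> x = ereal (1 / 2 * (norm (K x - g))\<^sup>2 + \<alpha> * (\<Sum>\<^sub>\<infinity>i. \<bar>coord x i\<bar>))"
  by (simp add: tikhonov_def ell1_norm_summable[OF assms])

lemma minimizer_summable:
  assumes "0 < \<alpha>" and min: "is_arg_min (tikhonov K g \<alpha>) (\<lambda>_. True) v"
  shows "(\<lambda>i. \<bar>coord v i\<bar>) summable_on UNIV"
proof (rule ell1_norm_finite_imp_summable)
  have "tikhonov K g \<alpha> v \<le> tikhonov K g \<alpha> 0"
    using min by (auto simp: is_arg_min_def not_less)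
  also have "\<dots> < \<infinity>"
    by (subst tikhonov_summable) simp_all
  finally show "ell1_norm v \<noteq> \<infinity>"
    using assms(1) by (auto simp: tikhonov_def)
qed

lemma minimizer_le:
  assumes "0 < \<alpha>" and min: "is_arg_min (tikhonov K g \<alpha>) (\<lambda>_. True) v"
    and x: "(\<lambda>i. \<bar>coord x i\<bar>) summable_on UNIV"
  shows "1 / 2 * (norm (K v - g))\<^sup>2 + \<alpha> * (\<Sum>\<^sub>\<infinity>i. \<bar>coord v i\<bar>)
    \<le> 1 / 2 * (norm (K x - g))\<^sup>2 + \<alpha> * (\<Sum>\<^sub>\<infinity>i. \<bar>coord x i\<bar>)"
proof -
  have "tikhonov K g \<alpha> v \<le> tikhonov K g \<alpha> x"
    using min by (auto simp: is_arg_min_def not_less)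
  then show ?thesis
    by (simp only: tikhonov_summable[OF x] tikhonov_summable[OF minimizer_summable[OF assms(1,2)]]
        ereal_less_eq)
qed

lemma norm_add_square:
  fixes a b :: "'a::real_inner"
  shows "(norm (a + b))\<^sup>2 = (norm a)\<^sup>2 + 2 * inner a b + (norm b)\<^sup>2"
  by (simp add: dot_norm field_simps)

text \<open>
  The first-order condition of a function with a kink at its minimum: dividing by $|t|$ and letting
  $t\to 0$ with the sign opposite to that of $b$ leaves $|b|\le\alpha$.
\<close>

lemma linear_coefficient_bound:
  fixes a b \<alpha> :: real
  assumes a: "0 \<le> a" and le: "\<And>t. 0 \<le> 1 / 2 * t\<^sup>2 * a + t * b + \<alpha> * \<bar>t\<bar>"
  shows "\<bar>b\<bar> \<le> \<alpha>"
proof (rule ccontr)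
  assume "\<not> \<bar>b\<bar> \<le> \<alpha>"
  \<comment> \<open>The step is so short that the quadratic term is below half of the linear gain.\<close>
  define \<delta> s where "\<delta> = \<bar>b\<bar> - \<alpha>" and "s = \<delta> / (a + 1)"
  have d: "0 < \<delta>" and s: "0 < s"
    using \<open>\<not> \<bar>b\<bar> \<le> \<alpha>\<close> a by (auto simp: \<delta>_def s_def)
  have "0 \<le> 1 / 2 * s\<^sup>2 * a - s * \<bar>b\<bar> + \<alpha> * s"
    using le[of s] le[of "- s"] s by (cases "0 \<le> b") auto
  also have "\<dots> = s * (1 / 2 * (s * a) - \<delta>)"
    by (simp add: \<delta>_def power2_eq_square algebra_simps)
  finally have "\<delta> \<le> 1 / 2 * (s * a)"
    using s by (simp add: zero_le_mult_iff)
  moreover have "s * (a + 1) = \<delta>"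
    using a by (simp add: s_def)
  then have "s * a + s = \<delta>"
    by (simp add: distrib_left)
  ultimately show False
    using s d by linarith
qed

text \<open>
  Moving a minimizer by $te_j$ changes the $\ell^1$-norm by at most $|t|$ and the discrepancy by a quadratic
  polynomial in $t$ whose linear coefficient is $\langle Kv-g, Ke_j\rangle$.
\<close>

lemma minimizer_stationary:
  fixes K :: "ell2 \<Rightarrow> 'h::real_inner"
  assumes K: "linear K" and \<alpha>: "0 < \<alpha>" and min: "is_arg_min (tikhonov K g \<alpha>) (\<lambda>_. True) v"
  shows "\<bar>inner (K v - g) (K (unit_seq j))\<bar> \<le> \<alpha>"
proof (rule linear_coefficient_bound)
  interpret linear K by (rule K)
  show "0 \<le> (norm (K (unit_seq j)))\<^sup>2" by simp
  fix t :: real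
  let ?w = "v + t *\<^sub>R unit_seq j"
  have v: "(\<lambda>i. \<bar>coord v i\<bar>) summable_on UNIV"
    by (rule minimizer_summable[OF \<alpha> min])
  have e: "((\<lambda>i. \<bar>coord (t *\<^sub>R unit_seq j) i\<bar>) has_sum \<bar>t\<bar>) UNIV"
    by (rule has_sum_finite_neutralI[of "{j}"]) (auto simp: coord_unit_seq)
  have sum: "((\<lambda>i. \<bar>coord v i\<bar> + \<bar>coord (t *\<^sub>R unit_seq j) i\<bar>) has_sum
      (\<Sum>\<^sub>\<infinity>i. \<bar>coord v i\<bar>) + \<bar>t\<bar>) UNIV"
    by (intro has_sum_add has_sum_infsum v e)
  have w: "(\<lambda>i. \<bar>coord ?w i\<bar>) summable_on UNIV"
    by (rule summable_on_comparison_test[OF has_sum_imp_summable[OF sum]])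
      (simp_all add: abs_triangle_ineq del: coord_simps(5))
  have l1: "(\<Sum>\<^sub>\<infinity>i. \<bar>coord ?w i\<bar>) \<le> (\<Sum>\<^sub>\<infinity>i. \<bar>coord v i\<bar>) + \<bar>t\<bar>"
    by (rule has_sum_mono[OF has_sum_infsum[OF w] sum])
      (simp add: abs_triangle_ineq del: coord_simps(5))
  have Kw: "K ?w - g = (K v - g) + t *\<^sub>R K (unit_seq j)"
    by (simp add: add scale)
  have "(norm (K ?w - g))\<^sup>2 = (norm (K v - g))\<^sup>2 + 2 * (t * inner (K v - g) (K (unit_seq j)))
      + t\<^sup>2 * (norm (K (unit_seq j)))\<^sup>2"
    unfolding Kw norm_add_square by (simp add: power_mult_distrib)
  then show "0 \<le> 1 / 2 * t\<^sup>2 * (norm (K (unit_seq j)))\<^sup>2 + t * inner (K v - g) (K (unit_seq j)) + \<alpha> * \<bar>t\<bar>"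
    using minimizer_le[OF \<alpha> min w] mult_left_mono[OF l1, of \<alpha>] \<alpha> by (simp add: distrib_left)
qed

section \<open>Support recovery\<close>

context finite_support_problem
begin

lemma bounded_linear_fit: "bounded_linear fit"
  unfolding fit_def
  by (intro bounded_linear_sum bounded_linear_compose[OF bounded_linear_scaleR_left]
      bounded_linear_inner_left)

text \<open>
  A minimizer $v$ is compared with $Lv = (KP_I)^{\dagger}Kv$, for which $KLv$ is the orthogonal projection of
  $Kv$ onto $K(\operatorname{span}\{e_i : i\in I\})$. Since $Ku$ lies in this subspace, Pythagoras shows that passing from
  $v$ to $Lv$ increases half the squared discrepancy by at most $\langle Kv-KLv,\eta\rangle$. This increase and
  the new penalty $\alpha\|Lv\|_{\ell^1}$ add up to $\Phi(v)$ for a linear functional $\Phi$, when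
  the signs of $Lv$ are frozen. On basis vectors, $|\Phi(e_i)|\le\alpha$ for $i\in I$, where $L$ is the identity,
  and $|\Phi(e_i)|\le (1+S)N+\alpha S<\alpha$ for $i\notin I$. Hence $\Phi(v)<\alpha\|v\|_{\ell^1}$ as soon as
  $v$ has a nonzero entry outside $I$, and $Lv$ is then strictly better than $v$.
\<close>

lemma minimizer_supp_subset:
  assumes \<alpha>: "0 < \<alpha>" and min: "is_arg_min (tikhonov K g \<alpha>) (\<lambda>_. True) v"
    and g: "g = K u + \<eta>" and u: "supp u \<subseteq> I"
    and N: "\<And>i. \<bar>inner \<eta> (K (unit_seq i))\<bar> \<le> N"
    and S: "\<And>i. i \<notin> I \<Longrightarrow> (\<Sum>j\<in>I. \<bar>coord (fit (K (unit_seq i))) j\<bar>) \<le> S"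
    and lower: "(1 + S) * N < \<alpha> * (1 - S)"
  shows "supp v \<subseteq> I"
proof (rule ccontr)
  assume "\<not> supp v \<subseteq> I"
  then obtain k where k: "k \<notin> I" "coord v k \<noteq> 0"
    by (auto simp: supp_def)
  define L where "L x = fit (K x)" for x
  \<comment> \<open>The signs are those of $Lv$ for the given minimizer, whatever the argument of $\Phi$: this makes
    $\Phi$ linear and still gives the full penalty of $Lv$ at $v$.\<close>
  define \<sigma> where "\<sigma> j = sgn (coord (L v) j)" for j
  define \<Phi> where "\<Phi> x = inner (K x - K (L x)) \<eta> + \<alpha> * (\<Sum>j\<in>I. \<sigma> j * coord (L x) j)" for x
  have sL: "supp (L x) \<subseteq> I" for x
    unfolding L_def by (rule supp_fit)
  have N0: "0 \<le> N"
    using N[of 0] by linarith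
  have L: "bounded_linear L"
    unfolding L_def by (rule bounded_linear_compose[OF bounded_linear_fit bounded_linear_K])
  have bl: "bounded_linear \<Phi>"
    unfolding \<Phi>_def
    by (intro bounded_linear_add bounded_linear_const_mult bounded_linear_sum
        bounded_linear_compose[OF bounded_linear_inner_left]
        bounded_linear_sub bounded_linear_K bounded_linear_compose[OF bounded_linear_K L]
        bounded_linear_compose[OF bounded_linear_coord L])
  have \<sigma>: "\<bar>\<sigma> j * t\<bar> \<le> \<bar>t\<bar>" for j t
    by (simp add: \<sigma>_def abs_mult sgn_if)
  have \<sigma>_self: "\<sigma> j * coord (L v) j = \<bar>coord (L v) j\<bar>" for j
    by (simp add: \<sigma>_def sgn_if)
  have lower': "N + S * N + \<alpha> * S < \<alpha>"
    using lower by (simp add: algebra_simps)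
  have outside: "\<bar>\<Phi> (unit_seq i)\<bar> < \<alpha>" if i: "i \<notin> I" for i
  proof -
    let ?l = "\<Sum>j\<in>I. \<bar>coord (L (unit_seq i)) j\<bar>"
    have l: "?l \<le> S"
      using S[OF i] by (simp add: L_def)
    have "inner (K (L (unit_seq i))) \<eta> = (\<Sum>j\<in>I. coord (L (unit_seq i)) j * inner \<eta> (K (unit_seq j)))"
      by (simp only: inner_commute[of _ \<eta>] inner_K_expand[OF sL])
    then have "\<bar>inner (K (L (unit_seq i))) \<eta>\<bar> \<le> (\<Sum>j\<in>I. \<bar>coord (L (unit_seq i)) j * inner \<eta> (K (unit_seq j))\<bar>)"
      by (simp only: sum_abs)
    also have "\<dots> \<le> (\<Sum>j\<in>I. \<bar>coord (L (unit_seq i)) j\<bar> * N)"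
      by (intro sum_mono) (simp add: abs_mult mult_left_mono N)
    also have "\<dots> \<le> S * N"
      using l N0 by (simp add: sum_distrib_right[symmetric] mult_right_mono)
    finally have "\<bar>inner (K (unit_seq i) - K (L (unit_seq i))) \<eta>\<bar> \<le> N + S * N"
      using N[of i] by (simp add: inner_diff_right inner_commute[of _ \<eta>])
    moreover have "\<bar>\<Sum>j\<in>I. \<sigma> j * coord (L (unit_seq i)) j\<bar> \<le> S"
      using l order_trans[OF sum_abs sum_mono[OF \<sigma>]] by (rule order_trans[rotated])
    then have "\<bar>\<alpha> * (\<Sum>j\<in>I. \<sigma> j * coord (L (unit_seq i)) j)\<bar> \<le> \<alpha> * S"
      using \<alpha> by (simp add: abs_mult)
    ultimately show ?thesis
      using lower' unfolding \<Phi>_def by linarith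
  qed
  have inside: "\<bar>\<Phi> (unit_seq i)\<bar> \<le> \<alpha>" if i: "i \<in> I" for i
  proof -
    have "L (unit_seq i) = unit_seq i"
      unfolding L_def by (rule fit_K) (use i in \<open>simp add: supp_unit_seq\<close>)
    then have "\<Phi> (unit_seq i) = \<alpha> * \<sigma> i"
      using i finite_I by (simp add: \<Phi>_def coord_unit_seq if_distrib[of "\<lambda>t. _ * t"] cong: if_cong)
    then show ?thesis
      using \<alpha> \<sigma>[of i 1] by (simp add: abs_mult)
  qed
  note v = minimizer_summable[OF \<alpha> min]
  have "\<bar>\<Phi> (unit_seq i)\<bar> \<le> \<alpha>" for i
    using inside[of i] outside[of i] by (cases "i \<in> I") simp_all
  then have "\<Phi> v < \<alpha> * (\<Sum>\<^sub>\<infinity>i. \<bar>coord v i\<bar>)"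
    using k outside by (intro functional_less_ell1[OF bl v, of _ k]) simp_all
  moreover have "\<Phi> v = inner (K v - K (L v)) \<eta> + \<alpha> * (\<Sum>j\<in>I. \<bar>coord (L v) j\<bar>)"
    by (simp only: \<Phi>_def \<sigma>_self)
  moreover have "1 / 2 * (norm (K v - g))\<^sup>2 + \<alpha> * (\<Sum>\<^sub>\<infinity>i. \<bar>coord v i\<bar>)
      \<le> 1 / 2 * (norm (K (L v) - g))\<^sup>2 + \<alpha> * (\<Sum>j\<in>I. \<bar>coord (L v) j\<bar>)"
    using minimizer_le[OF \<alpha> min has_sum_imp_summable[OF has_sum_abs_coord_finite[OF finite_I sL]]]
    unfolding infsumI[OF has_sum_abs_coord_finite[OF finite_I sL]] .
  moreover have "1 / 2 * (norm (K (L v) - g))\<^sup>2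
      \<le> 1 / 2 * (norm (K v - g))\<^sup>2 + inner (K v - K (L v)) \<eta>"
  proof -
    let ?d = "K v - K (L v)"
    have s: "supp (L v - u) \<subseteq> I"
      using sL[of v] u by (simp add: supp_subset_iff)
    have orth: "inner ?d (K (L v) - K u) = 0"
      using residual_orthogonal[OF s, of "K v"] by (simp add: L_def diff)
    have split: "?d + (K (L v) - g) = K v - g"
      by simp
    have "(norm (K v - g))\<^sup>2 = (norm ?d)\<^sup>2 + 2 * inner ?d (K (L v) - g) + (norm (K (L v) - g))\<^sup>2"
      using norm_add_square[of ?d "K (L v) - g"] unfolding split .
    moreover have "inner ?d (K (L v) - g) = - inner ?d \<eta>"
      using orth by (simp add: g inner_diff_right inner_add_right)
    moreover have "1 / 2 * c \<le> 1 / 2 * a + e" if "a = d + 2 * b + c" "b = - e" "0 \<le> d" for a b c d e :: real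
      using that by (simp add: field_simps)
    ultimately show ?thesis
      using zero_le_power2 by metis
  qed
  ultimately show False by linarith
qed

text \<open>
  With $h=u-v$ the stationarity condition reads $|\langle Kh,Ke_j\rangle|\le\alpha+N$ for all $j$. The dual
  vector turns it into a bound for $h_k=\langle Kh,Kb_k\rangle$. By
  duality of $\ell^1$ and $\ell^\infty$, the factor lost is the $\ell^1$-norm of the column $b_k$ of the inverse Gram matrix. In this way
  the $\ell^1$-operator norm of that symmetric matrix controls the error in the supremum norm.
\<close>

lemma coefficient_error:
  assumes \<alpha>: "0 < \<alpha>" and min: "is_arg_min (tikhonov K g \<alpha>) (\<lambda>_. True) v"
    and g: "g = K u + \<eta>" and u: "supp u \<subseteq> I" and v: "supp v \<subseteq> I"
    and N: "\<And>i. \<bar>inner \<eta> (K (unit_seq i))\<bar> \<le> N"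
    and k: "k \<in> I" and G: "(\<Sum>i\<in>I. \<bar>coord (dual k) i\<bar>) \<le> G"
  shows "\<bar>coord u k - coord v k\<bar> \<le> (\<alpha> + N) * G"
proof -
  let ?h = "u - v"
  have h: "supp ?h \<subseteq> I"
    using u v by (simp add: supp_subset_iff)
  have N0: "0 \<le> N"
    using N[of 0] by linarith
  have bound: "\<bar>inner (K ?h) (K (unit_seq j))\<bar> \<le> \<alpha> + N" for j
  proof -
    have "inner (K ?h) (K (unit_seq j)) = - inner (K v - g) (K (unit_seq j)) - inner \<eta> (K (unit_seq j))"
      by (simp add: g diff inner_diff_left inner_add_left)
    then show ?thesis
      using minimizer_stationary[OF linear_axioms \<alpha> min, of j] N[of j] by linarith
  qed
  have "inner (K (dual k)) (K ?h) = (\<Sum>j\<in>I. coord ?h j * inner (K (dual k)) (K (unit_seq j)))"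
    by (rule inner_K_expand[OF h])
  also have "\<dots> = coord ?h k"
    using finite_I k by (simp add: dual_biorthogonal if_distrib[of "\<lambda>t. _ * t"] cong: if_cong)
  finally have "coord ?h k = inner (K (dual k)) (K ?h)" ..
  also have "\<dots> = (\<Sum>j\<in>I. coord (dual k) j * inner (K ?h) (K (unit_seq j)))"
    by (simp only: inner_commute[of _ "K ?h"] inner_K_expand[OF supp_dual[OF k]])
  finally have "\<bar>coord ?h k\<bar> \<le> (\<Sum>j\<in>I. \<bar>coord (dual k) j * inner (K ?h) (K (unit_seq j))\<bar>)"
    by (simp only: sum_abs)
  also have "\<dots> \<le> (\<Sum>j\<in>I. \<bar>coord (dual k) j\<bar> * (\<alpha> + N))"
    by (intro sum_mono) (simp only: abs_mult mult_left_mono bound abs_ge_zero)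
  also have "\<dots> \<le> (\<alpha> + N) * G"
    unfolding sum_distrib_right[symmetric] mult.commute[of "\<alpha> + N"]
    using G \<alpha> N0 by (intro mult_right_mono) auto
  finally show ?thesis by simp
qed

end

lemma noise_level_real:
  assumes "bounded_linear K"
  obtains N where "noise_level K \<eta> = ereal N" "\<And>i. \<bar>inner \<eta> (K (unit_seq i))\<bar> \<le> N"
proof -
  have le: "ereal \<bar>inner \<eta> (K (unit_seq i))\<bar> \<le> noise_level K \<eta>" for i
    unfolding noise_level_def by (rule SUP_upper) simp
  have "\<bar>inner \<eta> (K (unit_seq i))\<bar> \<le> norm \<eta> * onorm K" for i
  proof -
    have "norm (unit_seq i) = 1"
      by (simp add: norm_eq_sqrt_inner inner_unit_seq coord_unit_seq)
    then have "norm (K (unit_seq i)) \<le> onorm K"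
      using onorm[OF assms, of "unit_seq i"] by simp
    then show ?thesis
      by (meson Cauchy_Schwarz_ineq2 mult_left_mono norm_ge_zero order_trans)
  qed
  then have "noise_level K \<eta> \<le> ereal (norm \<eta> * onorm K)"
    unfolding noise_level_def by (intro SUP_least) simp
  then obtain N where N: "noise_level K \<eta> = ereal N"
    using le[of 0] by (cases "noise_level K \<eta>") auto
  show thesis
    using that[OF N] le by (simp add: N)
qed

text \<open>
  Nonnegativity uses that $I$ is finite, so that the supremum is not over an empty family, whose
  supremum in the extended reals would be $-\infty$.
\<close>

lemma (in finite_support_problem) recovery_sup_real:
  assumes "recovery_sup K I < 1"
  obtains S where "recovery_sup K I = ereal S" "0 \<le> S" "S < 1"
    "\<And>i. i \<notin> I \<Longrightarrow> (\<Sum>j\<in>I. \<bar>coord (fit (K (unit_seq i))) j\<bar>) \<le> S"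
proof -
  have le: "ereal (\<Sum>j\<in>I. \<bar>coord (fit (K (unit_seq i))) j\<bar>) \<le> recovery_sup K I" if "i \<notin> I" for i
    unfolding recovery_sup_def
    using that by (intro SUP_upper2[of i])
      (simp_all add: pinv_eq_fit ell1_norm_finite_supp[OF finite_I supp_fit])
  obtain i where i: "i \<notin> I"
    using finite_I ex_new_if_finite[of I] infinite_UNIV_int by blast
  have "0 \<le> recovery_sup K I"
    using order_trans[OF _ le[OF i], of 0] by (simp add: sum_nonneg)
  then obtain S where S: "recovery_sup K I = ereal S"
    using assms by (cases "recovery_sup K I") auto
  show thesis
    using that[OF S] le assms \<open>0 \<le> recovery_sup K I\<close> by (simp add: S)
qed

theorem theorem4p5:
  fixes K :: "ell2 \<Rightarrow> 'h :: {real_inner, complete_space}"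
    and u :: ell2 and I :: "int set" and \<eta> g :: 'h
  assumes "separable_space (euclidean :: 'h topology)"
    and "bounded_linear K" and "FBI K"
    and "u \<in> ell0" and "u \<noteq> 0" and "supp u = I"
    and "g = K u + \<eta>"
    and "recovery_sup K I < 1 - 2 * noise_to_signal K u \<eta> * gram_inv_norm K I"
  shows "(\<exists>\<alpha>::real. \<alpha> > 0 \<and>
            (1 + recovery_sup K I) / (1 - recovery_sup K I) * noise_level K \<eta> < ereal \<alpha> \<and>
            ereal \<alpha> < min_coeff u / gram_inv_norm K I - noise_level K \<eta>) \<and>
         (\<forall>\<alpha>::real. \<alpha> > 0 \<and>
            (1 + recovery_sup K I) / (1 - recovery_sup K I) * noise_level K \<eta> < ereal \<alpha> \<and>
            ereal \<alpha> < min_coeff u / gram_inv_norm K I - noise_level K \<eta> \<longrightarrow>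
            (\<forall>v. is_arg_min (tikhonov K g \<alpha>) (\<lambda>_. True) v \<longrightarrow> supp v = supp u \<and> supp u = I))"
proof -
  have finI: "finite I"
    using assms(4,6) by (simp add: ell0_def)
  interpret finite_support_problem K I
    by (rule finite_support_problem.intro[OF assms(2,3) finI])
  have ne: "I \<noteq> {}"
    using assms(5,6) by (auto simp: supp_def intro!: ell2_eqI)
  obtain G where G: "gram_inv_norm K I = ereal G" "0 < G"
    "\<And>k. k \<in> I \<Longrightarrow> (\<Sum>i\<in>I. \<bar>coord (dual k) i\<bar>) \<le> G"
    using gram_inv_norm_real[OF ne] by metis
  obtain N where N: "noise_level K \<eta> = ereal N" "\<And>i. \<bar>inner \<eta> (K (unit_seq i))\<bar> \<le> N"
    using noise_level_real[OF assms(2)] by metis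
  have N0: "0 \<le> N"
    using N(2)[of 0] by linarith
  define m where "m = Min ((\<lambda>i. \<bar>coord u i\<bar>) ` I)"
  have m: "min_coeff u = ereal m"
    by (simp add: min_coeff_def m_def assms(6))
  have m_le: "m \<le> \<bar>coord u k\<bar>" if "k \<in> I" for k
    unfolding m_def using that finI by (intro Min_le) auto
  have m0: "0 < m"
    unfolding m_def using finI ne assms(6) by (subst Min_gr_iff) (auto simp: supp_def)
  have cond: "recovery_sup K I < ereal (1 - 2 * (N / m) * G)"
    using assms(8) m0 by (simp add: noise_to_signal_def N(1) m G(1) one_ereal_def)
  also have "\<dots> \<le> 1"
    using N0 m0 G(2) by (simp add: one_ereal_def)
  finally obtain S where S: "recovery_sup K I = ereal S" "0 \<le> S" "S < 1"
    "\<And>i. i \<notin> I \<Longrightarrow> (\<Sum>j\<in>I. \<bar>coord (fit (K (unit_seq i))) j\<bar>) \<le> S"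
    using recovery_sup_real by metis
  have low: "(1 + recovery_sup K I) / (1 - recovery_sup K I) * noise_level K \<eta> = ereal ((1 + S) / (1 - S) * N)"
    using S(3) by (simp add: S(1) N(1) one_ereal_def)
  have up: "min_coeff u / gram_inv_norm K I - noise_level K \<eta> = ereal (m / G - N)"
    using G(2) by (simp add: m G(1) N(1))
  have "2 * N / (1 - S) < m / G"
    using cond S(3) m0 G(2) by (simp add: S(1) field_simps)
  moreover have "(1 + S) / (1 - S) * N + N = 2 * N / (1 - S)"
    using S(3) by (simp add: field_simps)
  ultimately have gap: "(1 + S) / (1 - S) * N < m / G - N"
    by linarith
  have low0: "0 \<le> (1 + S) / (1 - S) * N"
    using S N0 by simp
  have ex: "\<exists>\<alpha>. \<alpha> > 0 \<and> (1 + S) / (1 - S) * N < \<alpha> \<and> \<alpha> < m / G - N"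
    using dense[OF gap] low0 by (meson le_less_trans)
  have "supp v = I"
    if \<alpha>: "\<alpha> > 0" "(1 + S) / (1 - S) * N < \<alpha>" "\<alpha> < m / G - N"
      and min: "is_arg_min (tikhonov K g \<alpha>) (\<lambda>_. True) v" for \<alpha> v
  proof
    have "(1 + S) * N < \<alpha> * (1 - S)"
      using \<alpha>(2) S(3) by (simp add: field_simps)
    with \<alpha>(1) min assms(7) equalityD1[OF assms(6)] N(2) S(4) show sub: "supp v \<subseteq> I"
      by (rule minimizer_supp_subset)
    show "I \<subseteq> supp v"
    proof
      fix k assume k: "k \<in> I"
      have "\<bar>coord u k - coord v k\<bar> \<le> (\<alpha> + N) * G"
        by (rule coefficient_error[OF \<alpha>(1) min assms(7) equalityD1[OF assms(6)] sub N(2) k G(3)[OF k]])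
      also have "\<dots> < m"
        using \<alpha>(3) G(2) by (simp add: field_simps)
      finally show "k \<in> supp v"
        using m_le[OF k] by (auto simp: supp_def)
    qed
  qed
  then have all: "\<forall>\<alpha>. \<alpha> > 0 \<and> (1 + S) / (1 - S) * N < \<alpha> \<and> \<alpha> < m / G - N \<longrightarrow>
      (\<forall>v. is_arg_min (tikhonov K g \<alpha>) (\<lambda>_. True) v \<longrightarrow> supp v = supp u \<and> supp u = I)"
    using assms(6) by (intro allI impI conjI) (elim conjE, simp only:)+
  show ?thesis
    unfolding low up less_ereal.simps(1) by (rule conjI[OF ex all])
qed

end
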